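(* Let $X$ be a polyhedron and $\gamma>0$ a fixed but arbitrary scalar. Let each constraint function be $\bullet$ for the restricted problem: $c_{k\ell}(\bullet,z;\gamma)=c_{k\ell}^{\rm rst}(\bullet,z;\gamma)$ for all $(k,\ell)\in[K]\times[L]$; $\bullet$ for the relaxed problem: $c_{k\ell}(\bullet,z;\gamma)=c_{k\ell}^{\rm rlx}(\bullet,z;\gamma)$ for all $(k,\ell)\in[K]\times[L]$. Suppose that $\{g_{i\ell}(\bullet,z)\}_{i=1}^{I_\ell}$ and $\{h_{j\ell}(\bullet,z)\}_{j=1}^{J_\ell}$ are all affine functions. Then $c_{k\ell}(\bullet,z;\gamma)$ is convex-like near any $\bar x\in X$ for all $(k,\ell)\in[K]\times[L]$, provided that $\bullet$ for the restricted problem: $\widehat\theta_{\rm cvx}$ and $\widehat\theta_{\rm cve}$ are convex and concave functions, respectively; $\bullet$ for the relaxed problem: $\widehat\theta_{\rm cvx}$ and $\widehat\theta_{\rm cve}$ are piecewise affine (not necessarily convex/concave). If, additionally, the objective function $c_0(\bullet,z)$ is convex-like near a B-stationary point $\bar x$ of the empirical problem $$\operatorname*{minimize}_{x\in X}\ \frac1N\sum_{s=1}^Nc_0(x,z^s)\quad\text{subject to}\quad \frac1N\sum_{s=1}^N\sum_{\ell=1}^Lc_{k\ell}(x,z^s;\gamma)\le\zeta_k,\quad k=1,\dots,K,$$ and $\bar x$ satisfies the Abadie constraint qualification for the feasible set $\overline X(Z^N;\gamma)$ of this problem, then $\bar x$ is a local minimizer of this problem.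
   Context: Notation: $[K]=\{1,\dots,K\}$; $f'(x;v)$ is the one-sided directional derivative. A function $f:\mathbb R^n\to\mathbb R$ is convex-like near $\bar x$ if there is a neighborhood $\mathcal N$ of $\bar x$ with $f(x)\ge f(\bar x)+f'(\bar x;x-\bar x)$ for all $x\in\mathcal N$. Functionals: for $\ell\in[L]$, $\mathcal Z_\ell(x,z)=\max_{1\le i\le I_\ell}g_{i\ell}(x,z)-\max_{1\le j\le J_\ell}h_{j\ell}(x,z)$. The functions $\widehat\theta_{\rm cvx},\widehat\theta_{\rm cve}:\mathbb R\to\mathbb R$ take value $0$ at $0$ and $1$ at $1$, and are increasing on $[0,1]$ and nondecreasing outside (with convexity of $\widehat\theta_{\rm cvx}$/concavity of $\widehat\theta_{\rm cve}$, or piecewise affineness, as specified in the claim). For $\gamma>0$: $\phi_{\rm ub}(t,\gamma)=\min\{\max(\widehat\theta_{\rm cvx}(1+\frac t\gamma),0),1\}$ and $\phi_{\rm lb}(t,\gamma)=\max\{\min(\widehat\theta_{\rm cve}(\frac t\gamma),1),0\}$. Given $e_{k\ell}\in\mathbb R$ with $e_{k\ell}^+=\max(e_{k\ell},0)$, $e_{k\ell}^-=\max(-e_{k\ell},0)$: $$c_{k\ell}^{\rm rlx}(x,z;\gamma)=e_{k\ell}^+\phi_{\rm lb}(\mathcal Z_\ell(x,z),\gamma)-e_{k\ell}^-\phi_{\rm ub}(\mathcal Z_\ell(x,z),\gamma),\qquad c_{k\ell}^{\rm rst}(x,z;\gamma)=e_{k\ell}^+\phi_{\rm ub}(\mathcal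 Z_\ell(x,z),\gamma)-e_{k\ell}^-\phi_{\rm lb}(\mathcal Z_\ell(x,z),\gamma).$$ Standing assumption: $c_0(\bullet,z)$ is directionally differentiable and globally Lipschitz continuous. $Z^N=\{z^s\}_{s=1}^N$ is a fixed family of samples in $\Xi\subseteq\mathbb R^d$, $\zeta_k\in\mathbb R$. Tangent cone $\mathcal T(\bar x;C)$: the set of limits of $(x^\nu-\bar x)/\tau_\nu$ with $C\ni x^\nu\to\bar x$, $\tau_\nu\downarrow0$. $\bar x\in C$ is a B-stationary point of minimizing $f_0$ over $C$ if $f_0'(\bar x;v)\ge0$ for all $v\in\mathcal T(\bar x;C)$. For $\widehat X=\{x\in X:f_k(x)\le0,\ k\in[K]\}$ with $X$ a polyhedron and $f_k$ locally Lipschitz and directionally differentiable, the linearization cone at $\bar x\in\widehat X$ is $\mathcal L(\bar x;\widehat X)=\{v\in\mathcal T(\bar x;X):f_k'(\bar x;v)\le0\ \forall k\text{ with }f_k(\bar x)=0\}$; the Abadie constraint qualification (ACQ) holds for $\widehat X$ at $\bar x$ if $\mathcal T(\bar x;\widehat X)=\mathcal L(\bar x;\widehat X)$. Here $f_k(x)=\frac1N\sum_s\sum_\ell c_{k\ell}(x,z^s;\gamma)-\zeta_k$. *)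

theory Defs
  imports "HOL-Analysis.Analysis"
begin

definition has_dir_deriv :: "('a::real_normed_vector \<Rightarrow> real) \<Rightarrow> 'a \<Rightarrow> 'a \<Rightarrow> real \<Rightarrow> bool" where
  "has_dir_deriv f x v d \<longleftrightarrow> ((\<lambda>t. (f (x + t *\<^sub>R v) - f x) / t) \<longlongrightarrow> d) (at_right 0)"

definition dir_differentiable :: "('a::real_normed_vector \<Rightarrow> real) \<Rightarrow> 'a \<Rightarrow> bool" where
  "dir_differentiable f x \<longleftrightarrow> (\<forall>v. \<exists>d. has_dir_deriv f x v d)"

text \<open>Unspecified if the one-sided limit does not exist.\<close>
definition dir_deriv :: "('a::real_normed_vector \<Rightarrow> real) \<Rightarrow> 'a \<Rightarrow> 'a \<Rightarrow> real" where
  "dir_deriv f x v = (THE d. has_dir_deriv f x v d)"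

text \<open>The first conjunct guarantees that the directional derivatives in the inequality exist.\<close>
definition convex_like_near :: "('a::real_normed_vector \<Rightarrow> real) \<Rightarrow> 'a \<Rightarrow> bool" where
  "convex_like_near f xb \<longleftrightarrow>
     dir_differentiable f xb \<and>
     (\<exists>U. open U \<and> xb \<in> U \<and> (\<forall>x\<in>U. f x \<ge> f xb + dir_deriv f xb (x - xb)))"

definition affine_fun :: "('a::real_inner \<Rightarrow> real) \<Rightarrow> bool" where
  "affine_fun f \<longleftrightarrow> (\<exists>a b. \<forall>x. f x = a \<bullet> x + b)"

text \<open>A continuous selection of finitely many affine functions.\<close>
definition piecewise_affine :: "('a::real_inner \<Rightarrow> real) \<Rightarrow> bool" where
  "piecewise_affine f \<longleftrightarrow>
     continuous_on UNIV f \<and>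
     (\<exists>P. finite P \<and> (\<forall>p\<in>P. affine_fun p) \<and> (\<forall>x. \<exists>p\<in>P. f x = p x))"

definition tangent_cone :: "'a::real_normed_vector \<Rightarrow> 'a set \<Rightarrow> 'a set" where
  "tangent_cone xb C =
     {v. \<exists>(x :: nat \<Rightarrow> 'a) (\<tau> :: nat \<Rightarrow> real).
           (\<forall>\<nu>. x \<nu> \<in> C) \<and> x \<longlonglongrightarrow> xb \<and> (\<forall>\<nu>. \<tau> \<nu> > 0) \<and> \<tau> \<longlonglongrightarrow> 0 \<and>
           (\<lambda>\<nu>. (x \<nu> - xb) /\<^sub>R \<tau> \<nu>) \<longlonglongrightarrow> v}"

definition B_stationary :: "('a::real_normed_vector \<Rightarrow> real) \<Rightarrow> 'a set \<Rightarrow> 'a \<Rightarrow> bool" where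
  "B_stationary f C xb \<longleftrightarrow> xb \<in> C \<and> (\<forall>v\<in>tangent_cone xb C. dir_deriv f xb v \<ge> 0)"

definition local_minimizer :: "('a::real_normed_vector \<Rightarrow> real) \<Rightarrow> 'a set \<Rightarrow> 'a \<Rightarrow> bool" where
  "local_minimizer f C xb \<longleftrightarrow>
     xb \<in> C \<and> (\<exists>U. open U \<and> xb \<in> U \<and> (\<forall>x\<in>C \<inter> U. f xb \<le> f x))"

definition constraint_set :: "'a set \<Rightarrow> nat \<Rightarrow> (nat \<Rightarrow> 'a \<Rightarrow> real) \<Rightarrow> 'a set" where
  "constraint_set X K f = {x \<in> X. \<forall>k\<in>{1..K}. f k x \<le> 0}"

definition linearization_cone ::
    "'a::real_normed_vector set \<Rightarrow> nat \<Rightarrow> (nat \<Rightarrow> 'a \<Rightarrow> real) \<Rightarrow> 'a \<Rightarrow> 'a set" where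
  "linearization_cone X K f xb =
     {v \<in> tangent_cone xb X. \<forall>k\<in>{1..K}. f k xb = 0 \<longrightarrow> dir_deriv (f k) xb v \<le> 0}"

definition ACQ :: "'a::real_normed_vector set \<Rightarrow> nat \<Rightarrow> (nat \<Rightarrow> 'a \<Rightarrow> real) \<Rightarrow> 'a \<Rightarrow> bool" where
  "ACQ X K f xb \<longleftrightarrow>
     xb \<in> constraint_set X K f \<and>
     tangent_cone xb (constraint_set X K f) = linearization_cone X K f xb"

definition theta_admissible :: "(real \<Rightarrow> real) \<Rightarrow> bool" where
  "theta_admissible \<theta> \<longleftrightarrow>
     \<theta> 0 = 0 \<and> \<theta> 1 = 1 \<and> strict_mono_on {0..1} \<theta> \<and> mono_on {..0} \<theta> \<and> mono_on {1..} \<theta>"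

definition phi_ub :: "(real \<Rightarrow> real) \<Rightarrow> real \<Rightarrow> real \<Rightarrow> real" where
  "phi_ub \<theta> t \<gamma> = min (max (\<theta> (1 + t / \<gamma>)) 0) 1"

definition phi_lb :: "(real \<Rightarrow> real) \<Rightarrow> real \<Rightarrow> real \<Rightarrow> real" where
  "phi_lb \<theta> t \<gamma> = max (min (\<theta> (t / \<gamma>)) 1) 0"

definition Z_fun ::
    "(nat \<Rightarrow> nat \<Rightarrow> 'a \<Rightarrow> 'b \<Rightarrow> real) \<Rightarrow> (nat \<Rightarrow> nat \<Rightarrow> 'a \<Rightarrow> 'b \<Rightarrow> real) \<Rightarrow>
     (nat \<Rightarrow> nat) \<Rightarrow> (nat \<Rightarrow> nat) \<Rightarrow> nat \<Rightarrow> 'a \<Rightarrow> 'b \<Rightarrow> real" where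
  "Z_fun g h I J l x z =
     Max ((\<lambda>i. g i l x z) ` {1..I l}) - Max ((\<lambda>j. h j l x z) ` {1..J l})"

definition c_rlx ::
    "(nat \<Rightarrow> nat \<Rightarrow> real) \<Rightarrow> (real \<Rightarrow> real) \<Rightarrow> (real \<Rightarrow> real) \<Rightarrow> (nat \<Rightarrow> 'a \<Rightarrow> 'b \<Rightarrow> real) \<Rightarrow>
     nat \<Rightarrow> nat \<Rightarrow> 'a \<Rightarrow> 'b \<Rightarrow> real \<Rightarrow> real" where
  "c_rlx e \<theta>cvx \<theta>cve Z k l x z \<gamma> =
     max (e k l) 0 * phi_lb \<theta>cve (Z l x z) \<gamma> - max (- e k l) 0 * phi_ub \<theta>cvx (Z l x z) \<gamma>"

definition c_rst ::
    "(nat \<Rightarrow> nat \<Rightarrow> real) \<Rightarrow> (real \<Rightarrow> real) \<Rightarrow> (real \<Rightarrow> real) \<Rightarrow> (nat \<Rightarrow> 'a \<Rightarrow> 'b \<Rightarrow> real) \<Rightarrow>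
     nat \<Rightarrow> nat \<Rightarrow> 'a \<Rightarrow> 'b \<Rightarrow> real \<Rightarrow> real" where
  "c_rst e \<theta>cvx \<theta>cve Z k l x z \<gamma> =
     max (e k l) 0 * phi_ub \<theta>cvx (Z l x z) \<gamma> - max (- e k l) 0 * phi_lb \<theta>cve (Z l x z) \<gamma>"

definition emp_objective :: "('a \<Rightarrow> 'b \<Rightarrow> real) \<Rightarrow> nat \<Rightarrow> (nat \<Rightarrow> 'b) \<Rightarrow> 'a \<Rightarrow> real" where
  "emp_objective c0 N zs x = 1 / real N * (\<Sum>s=1..N. c0 x (zs s))"

definition emp_constraint ::
    "(nat \<Rightarrow> nat \<Rightarrow> 'a \<Rightarrow> 'b \<Rightarrow> real \<Rightarrow> real) \<Rightarrow> nat \<Rightarrow> nat \<Rightarrow> (nat \<Rightarrow> 'b) \<Rightarrow> (nat \<Rightarrow> real) \<Rightarrow> real \<Rightarrow>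
     nat \<Rightarrow> 'a \<Rightarrow> real" where
  "emp_constraint c L N zs \<zeta> \<gamma> k x =
     1 / real N * (\<Sum>s=1..N. \<Sum>l=1..L. c k l x (zs s) \<gamma>) - \<zeta> k"

end

theory Submission
  imports Defs
begin

text \<open>
  A minimum of two continuous functions that are convex-like near a point is again convex-like
  near it, although a minimum of convex functions need not be convex. Hence the truncation
  \<open>min (max \<theta> a) b\<close> of a convex \<open>\<theta>\<close> is convex-like everywhere. This survives composition
  with a function that equals its value plus a positively homogeneous function of the increment
  near the point, as differences of maxima of affine functions do: the composition merely
  transports directional derivatives. If \<open>\<theta>\<close> is piecewise affine, then the whole composition
  is itself of that form, whatever the signs of the coefficients.

  For the local minimizer, a feasible \<open>x\<close> near \<open>xb\<close> gives a direction \<open>x - xb\<close> in the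
  linearization cone, because convex-likeness of an active constraint forces its directional
  derivative to be nonpositive. By Abadie this direction is tangent to the feasible set,
  so stationarity together with convex-likeness of the objective yields the claim.
\<close>

section \<open>Directional derivatives and convex-likeness with an explicit derivative map\<close>

lemma has_dir_deriv_unique:
  assumes "has_dir_deriv f x v d" "has_dir_deriv f x v d'"
  shows "d = d'"
  using assms unfolding has_dir_deriv_def
  by (rule tendsto_unique[OF trivial_limit_at_right_real])

lemma dir_deriv_eq:
  assumes "has_dir_deriv f x v d"
  shows "dir_deriv f x v = d"
  unfolding dir_deriv_def using assms has_dir_deriv_unique by blast

text \<open>Trading the definite description in \<open>dir_deriv\<close> for a witness
  \<open>D\<close> lets each closure lemma simply exhibit the derivative of the combined function.
  The filter form makes the intersection of finitely many neighborhoods automatic.\<close>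

lemma convex_like_near_iff:
  "convex_like_near f x \<longleftrightarrow>
     (\<exists>D. (\<forall>v. has_dir_deriv f x v (D v)) \<and> (\<forall>\<^sub>F y in nhds x. f x + D (y - x) \<le> f y))"
  (is "_ \<longleftrightarrow> (\<exists>D. ?P D)")
proof
  assume L: "convex_like_near f x"
  then have "has_dir_deriv f x v (dir_deriv f x v)" for v
    using dir_deriv_eq unfolding convex_like_near_def dir_differentiable_def by metis
  then have "?P (dir_deriv f x)"
    using L unfolding convex_like_near_def eventually_nhds by blast
  then show "\<exists>D. ?P D" by (intro exI[of _ "dir_deriv f x"])
next
  assume "\<exists>D. ?P D"
  then obtain D where D: "?P D" ..
  then have "dir_deriv f x = D"
    using dir_deriv_eq by blast
  then show "convex_like_near f x"
    using D unfolding convex_like_near_def dir_differentiable_def eventually_nhds by blast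
qed

lemma convex_like_near_dir_deriv:
  assumes "convex_like_near f x"
  shows "\<forall>\<^sub>F y in nhds x. f x + dir_deriv f x (y - x) \<le> f y"
  using assms unfolding convex_like_near_def eventually_nhds by blast

text \<open>Short positive steps along a ray stay in any neighborhood of its origin. This carries
  identities valid near \<open>x\<close> over to difference quotients.\<close>

lemma eventually_ray:
  fixes x v :: "'a::real_normed_vector"
  assumes "\<forall>\<^sub>F y in nhds x. P y"
  shows "\<forall>\<^sub>F t in at_right 0. P (x + t *\<^sub>R v)"
proof -
  have "((\<lambda>t. x + t *\<^sub>R v) \<longlongrightarrow> x + 0 *\<^sub>R v) (at_right 0)"
    by (intro tendsto_intros)
  then show ?thesis
    using assms by (simp add: filterlim_iff)
qed

text \<open>The one-sided limits and the lower bound depend only on the germ at \<open>x\<close>;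
  the values at \<open>x\<close> agree because every neighborhood contains \<open>x\<close>.\<close>

lemma convex_like_near_cong:
  assumes "\<forall>\<^sub>F y in nhds x. f y = g y" and "convex_like_near g x"
  shows "convex_like_near f x"
proof -
  obtain D where D: "\<And>v. has_dir_deriv g x v (D v)"
      and le: "\<forall>\<^sub>F y in nhds x. g x + D (y - x) \<le> g y"
    using assms(2) unfolding convex_like_near_iff by blast
  have x: "f x = g x"
    using assms(1) by (rule eventually_nhds_x_imp_x)
  have "has_dir_deriv f x v (D v)" for v
    using D[of v] unfolding has_dir_deriv_def
    by (rule Lim_transform_eventually)
      (use eventually_ray[OF assms(1), of v] in eventually_elim, simp add: x)
  moreover have "\<forall>\<^sub>F y in nhds x. f x + D (y - x) \<le> f y"
    using le assms(1) by eventually_elim (simp add: x)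
  ultimately show ?thesis
    unfolding convex_like_near_iff by blast
qed

section \<open>Closure properties of convex-likeness, and convex functions\<close>

lemma convex_like_near_const: "convex_like_near (\<lambda>_. c) x"
  unfolding convex_like_near_iff has_dir_deriv_def by (intro exI[of _ "\<lambda>_. 0"]) simp

lemma convex_like_near_add:
  assumes "convex_like_near f x" "convex_like_near g x"
  shows "convex_like_near (\<lambda>y. f y + g y) x"
proof -
  obtain D where D: "\<And>v. has_dir_deriv f x v (D v)"
      and leD: "\<forall>\<^sub>F y in nhds x. f x + D (y - x) \<le> f y"
    using assms(1) unfolding convex_like_near_iff by blast
  obtain E where E: "\<And>v. has_dir_deriv g x v (E v)"
      and leE: "\<forall>\<^sub>F y in nhds x. g x + E (y - x) \<le> g y"
    using assms(2) unfolding convex_like_near_iff by blast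
  have "has_dir_deriv (\<lambda>y. f y + g y) x v (D v + E v)" for v
    using tendsto_add[OF D[of v, unfolded has_dir_deriv_def] E[of v, unfolded has_dir_deriv_def]]
    by (simp add: has_dir_deriv_def add_divide_distrib[symmetric] algebra_simps)
  moreover have "\<forall>\<^sub>F y in nhds x. f x + g x + (D (y - x) + E (y - x)) \<le> f y + g y"
    using leD leE by eventually_elim simp
  ultimately show ?thesis
    unfolding convex_like_near_iff by (intro exI[of _ "\<lambda>v. D v + E v"]) simp
qed

lemma convex_like_near_cmult:
  assumes "convex_like_near f x" "a \<ge> 0"
  shows "convex_like_near (\<lambda>y. a * f y) x"
proof -
  obtain D where D: "\<And>v. has_dir_deriv f x v (D v)"
      and le: "\<forall>\<^sub>F y in nhds x. f x + D (y - x) \<le> f y"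
    using assms(1) unfolding convex_like_near_iff by blast
  have "has_dir_deriv (\<lambda>y. a * f y) x v (a * D v)" for v
    using tendsto_mult_left[OF D[of v, unfolded has_dir_deriv_def], of a]
    by (simp add: has_dir_deriv_def right_diff_distrib)
  moreover have "\<forall>\<^sub>F y in nhds x. a * f x + a * D (y - x) \<le> a * f y"
    using le
  proof eventually_elim
    case (elim y)
    then show ?case
      using mult_left_mono[OF elim assms(2)] by (simp add: distrib_left)
  qed
  ultimately show ?thesis
    unfolding convex_like_near_iff by (intro exI[of _ "\<lambda>v. a * D v"]) simp
qed

lemma convex_like_near_sum:
  assumes "\<And>i. i \<in> A \<Longrightarrow> convex_like_near (f i) x"
  shows "convex_like_near (\<lambda>y. \<Sum>i\<in>A. f i y) x"
  using assms
  by (induction A rule: infinite_finite_induct)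
    (simp_all add: convex_like_near_const convex_like_near_add)

text \<open>If the values at \<open>x\<close> differ, continuity makes the minimum coincide near
  \<open>x\<close> with the smaller function. At a tie, the minimum of the two derivatives is the
  derivative, and the two lower bounds combine.\<close>

lemma convex_like_near_min:
  assumes f: "convex_like_near f x" "isCont f x" and g: "convex_like_near g x" "isCont g x"
  shows "convex_like_near (\<lambda>y. min (f y) (g y)) x"
proof -
  have less: "\<forall>\<^sub>F y in nhds x. p y < q y"
    if "p x < q x" "isCont p x" "isCont q x" for p q :: "'a \<Rightarrow> real"
  proof -
    have "\<forall>\<^sub>F y in nhds x. 0 < q y - p y"
      using that by (intro order_tendstoD(1)[where y = "q x - p x"])
        (auto intro!: tendsto_diff simp: isCont_def tendsto_at_iff_tendsto_nhds)
    then show ?thesis by simp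
  qed
  consider "f x < g x" | "g x < f x" | "f x = g x" by linarith
  then show ?thesis
  proof cases
    case 1
    show ?thesis
      by (rule convex_like_near_cong[OF _ f(1)])
        (use less[OF 1 f(2) g(2)] in eventually_elim, simp)
  next
    case 2
    show ?thesis
      by (rule convex_like_near_cong[OF _ g(1)])
        (use less[OF 2 g(2) f(2)] in eventually_elim, simp)
  next
    case 3
    obtain D where D: "\<And>v. has_dir_deriv f x v (D v)"
        and leD: "\<forall>\<^sub>F y in nhds x. f x + D (y - x) \<le> f y"
      using f(1) unfolding convex_like_near_iff by blast
    obtain E where E: "\<And>v. has_dir_deriv g x v (E v)"
        and leE: "\<forall>\<^sub>F y in nhds x. g x + E (y - x) \<le> g y"
      using g(1) unfolding convex_like_near_iff by blast
    have "has_dir_deriv (\<lambda>y. min (f y) (g y)) x v (min (D v) (E v))" for v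
      unfolding has_dir_deriv_def
    proof (rule Lim_transform_eventually)
      show "((\<lambda>t. min ((f (x + t *\<^sub>R v) - f x) / t) ((g (x + t *\<^sub>R v) - g x) / t)) \<longlongrightarrow>
          min (D v) (E v)) (at_right 0)"
        using D E unfolding has_dir_deriv_def by (intro tendsto_min) auto
      \<comment> \<open>At a tie both numerators subtract the same value, and division by a positive
        \<open>t\<close> commutes with \<open>min\<close>.\<close>
      show "\<forall>\<^sub>F t in at_right 0.
          min ((f (x + t *\<^sub>R v) - f x) / t) ((g (x + t *\<^sub>R v) - g x) / t) =
          (min (f (x + t *\<^sub>R v)) (g (x + t *\<^sub>R v)) - min (f x) (g x)) / t"
        using eventually_at_right_less[of 0]
        by eventually_elim (simp add: 3 min_def divide_le_cancel)
    qed
    moreover have "\<forall>\<^sub>F y in nhds x. min (f x) (g x) + min (D (y - x)) (E (y - x)) \<le> min (f y) (g y)"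
      using leD leE by eventually_elim (auto simp: 3 min_def)
    ultimately show ?thesis
      unfolding convex_like_near_iff by (intro exI[of _ "\<lambda>v. min (D v) (E v)"]) simp
  qed
qed

text \<open>The difference quotient \<open>Q v\<close> is nondecreasing in the step and bounded
  below, so it decreases to its infimum \<open>D v\<close> as the step tends to 0. Being an infimum,
  \<open>D v\<close> lies below the quotient at step 1, which is the required inequality.\<close>

lemma convex_on_imp_convex_like_near:
  assumes "convex_on UNIV f"
  shows "convex_like_near f x"
proof -
  define Q where "Q v t = (f (x + t *\<^sub>R v) - f x) / t" for v t
  define D where "D v = Inf (Q v ` {0<..})" for v
  have comb: "f ((1 - u) *\<^sub>R a + u *\<^sub>R b) \<le> (1 - u) * f a + u * f b" if "0 \<le> u" "u \<le> 1" for a b u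
    using convex_onD[OF assms that] by simp
  have mono: "Q v s \<le> Q v t" if "0 < s" "s \<le> t" for v s t
  proof -
    \<comment> \<open>The shorter step lies on the segment from \<open>x\<close> to the endpoint of
      the longer one.\<close>
    have "x + s *\<^sub>R v = (1 - s / t) *\<^sub>R x + (s / t) *\<^sub>R (x + t *\<^sub>R v)"
      using that by (simp add: algebra_simps)
    then have "f (x + s *\<^sub>R v) \<le> (1 - s / t) * f x + s / t * f (x + t *\<^sub>R v)"
      using comb[of "s / t" x "x + t *\<^sub>R v"] that by simp
    then show ?thesis
      using that unfolding Q_def by (simp add: field_simps)
  qed
  have lb: "f x - f (x - v) \<le> Q v t" if "0 < t" for v t
  proof -
    \<comment> \<open>The weights 1/(1+t) and t/(1+t) represent \<open>x\<close> as a convex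
      combination of the forward point and the unit backward step \<open>x - v\<close>, which yields
      a bound independent of \<open>t\<close>.\<close>
    have "(1 / (1 + t)) *\<^sub>R (x + t *\<^sub>R v) + (1 - 1 / (1 + t)) *\<^sub>R (x - v)
        = (1 / (1 + t)) *\<^sub>R ((x + t *\<^sub>R v) + t *\<^sub>R (x - v))"
      using that by (simp add: field_simps scaleR_add_right scaleR_diff_right)
    also have "\<dots> = (1 / (1 + t)) *\<^sub>R ((1 + t) *\<^sub>R x)"
      by (simp add: algebra_simps)
    also have "\<dots> = x"
      using that by simp
    finally have "f x \<le> (1 - 1 / (1 + t)) * f (x - v) + 1 / (1 + t) * f (x + t *\<^sub>R v)"
      using comb[of "1 / (1 + t)" "x - v" "x + t *\<^sub>R v"] that by (simp add: add.commute)
    moreover have "1 - 1 / (1 + t) = t / (1 + t)"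
      using that by (simp add: field_simps)
    ultimately have "f x \<le> (t * f (x - v) + f (x + t *\<^sub>R v)) / (1 + t)"
      by (simp add: add_divide_distrib)
    then show ?thesis
      using that unfolding Q_def by (simp add: field_simps)
  qed
  have bdd: "bdd_below (Q v ` {0<..})" for v
    using lb by (auto intro!: bdd_belowI)
  have D_le: "D v \<le> Q v t" if "0 < t" for v t
    unfolding D_def using that by (intro cINF_lower bdd) auto
  have "has_dir_deriv f x v (D v)" for v
    unfolding has_dir_deriv_def Q_def[symmetric]
  proof (rule decreasing_tendsto)
    show "\<forall>\<^sub>F t in at_right 0. D v \<le> Q v t"
      using eventually_at_right_less[of 0] by eventually_elim (rule D_le)
  next
    fix y assume "D v < y"
    \<comment> \<open>Some quotient is already below \<open>y\<close>, and monotonicity passes this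
      on to all smaller steps.\<close>
    then obtain s where s: "0 < s" "Q v s < y"
      using cINF_less_iff[of "{0<..}" "Q v" y] bdd[of v] by (auto simp: D_def)
    have "\<forall>\<^sub>F t in at_right 0. t \<in> {0<..<s}"
      using s(1) by (rule eventually_at_right_real)
    then show "\<forall>\<^sub>F t in at_right 0. Q v t < y"
    proof eventually_elim
      case (elim t)
      then show ?case
        using mono[of t s v] s by simp
    qed
  qed
  moreover have "f x + D (y - x) \<le> f y" for y
    using D_le[of 1 "y - x"] by (simp add: Q_def)
  ultimately show ?thesis
    unfolding convex_like_near_iff by (intro exI[of _ D]) simp
qed

section \<open>Locally conic functions and their compositions\<close>

text \<open>A first-order expansion without remainder on a neighborhood. Unlike convex-likeness,
  this property is stable under negation and composition. The homogeneous part \<open>q\<close> may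
  be discontinuous, so continuity at \<open>x\<close> is demanded separately.\<close>

definition locally_conic :: "('a::real_normed_vector \<Rightarrow> real) \<Rightarrow> 'a \<Rightarrow> bool" where
  "locally_conic f x \<longleftrightarrow> isCont f x \<and>
     (\<exists>q. (\<forall>t>0. \<forall>v. q (t *\<^sub>R v) = t * q v) \<and> (\<forall>\<^sub>F y in nhds x. f y = f x + q (y - x)))"

lemma locally_conicI:
  assumes "isCont f x" "\<And>t v. t > 0 \<Longrightarrow> q (t *\<^sub>R v) = t * q v"
    "\<forall>\<^sub>F y in nhds x. f y = f x + q (y - x)"
  shows "locally_conic f x"
  using assms unfolding locally_conic_def by blast

lemma isCont_eventually_compose:
  assumes "isCont f x" "\<forall>\<^sub>F s in nhds (f x). P s"
  shows "\<forall>\<^sub>F y in nhds x. P (f y)"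
proof -
  have "filterlim f (nhds (f x)) (nhds x)"
    using assms(1) unfolding isCont_def tendsto_at_iff_tendsto_nhds .
  then show ?thesis
    using assms(2) unfolding filterlim_iff by blast
qed

lemma locally_conic_const: "locally_conic (\<lambda>_. c) x"
  by (rule locally_conicI[where q = "\<lambda>_. 0"]) auto

lemma locally_conic_affine:
  assumes "affine_fun f"
  shows "locally_conic f x"
proof -
  obtain a b where f: "f = (\<lambda>y. a \<bullet> y + b)"
    using assms unfolding affine_fun_def by blast
  show ?thesis
    unfolding f by (rule locally_conicI[where q = "\<lambda>v. a \<bullet> v"]) (auto simp: inner_diff_right)
qed

lemma locally_conic_add:
  assumes "locally_conic f x" "locally_conic g x"
  shows "locally_conic (\<lambda>y. f y + g y) x"
proof -
  obtain p where p: "isCont f x" "\<And>t v. t > 0 \<Longrightarrow> p (t *\<^sub>R v) = t * p v"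
      "\<forall>\<^sub>F y in nhds x. f y = f x + p (y - x)"
    using assms(1) unfolding locally_conic_def by blast
  obtain q where q: "isCont g x" "\<And>t v. t > 0 \<Longrightarrow> q (t *\<^sub>R v) = t * q v"
      "\<forall>\<^sub>F y in nhds x. g y = g x + q (y - x)"
    using assms(2) unfolding locally_conic_def by blast
  show ?thesis
  proof (rule locally_conicI[where q = "\<lambda>v. p v + q v"])
    show "\<forall>\<^sub>F y in nhds x. f y + g y = f x + g x + (p (y - x) + q (y - x))"
      using p(3) q(3) by eventually_elim simp
  qed (use p q in \<open>auto simp: distrib_left\<close>)
qed

text \<open>The homogeneous parts compose, and continuity of \<open>f\<close> at \<open>x\<close>
  pulls the neighborhood of \<open>f x\<close> back to one of \<open>x\<close>.\<close>

lemma locally_conic_compose: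
  assumes "locally_conic \<phi> (f x)" "locally_conic f x"
  shows "locally_conic (\<lambda>y. \<phi> (f y)) x"
proof -
  obtain p where p: "isCont \<phi> (f x)" "\<And>t v. t > 0 \<Longrightarrow> p (t *\<^sub>R v) = t * p v"
      "\<forall>\<^sub>F s in nhds (f x). \<phi> s = \<phi> (f x) + p (s - f x)"
    using assms(1) unfolding locally_conic_def by blast
  obtain q where q: "isCont f x" "\<And>t v. t > 0 \<Longrightarrow> q (t *\<^sub>R v) = t * q v"
      "\<forall>\<^sub>F y in nhds x. f y = f x + q (y - x)"
    using assms(2) unfolding locally_conic_def by blast
  show ?thesis
  proof (rule locally_conicI[where q = "\<lambda>v. p (q v)"])
    show "\<forall>\<^sub>F y in nhds x. \<phi> (f y) = \<phi> (f x) + p (q (y - x))"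
      using isCont_eventually_compose[OF q(1) p(3)] q(3)
      by eventually_elim simp
    show "p (q (t *\<^sub>R v)) = t * p (q v)" if "t > 0" for t v
      using p(2)[OF that, of "q v"] q(2)[OF that] by simp
  qed (use p(1) q(1) in \<open>rule isCont_o2[rotated]\<close>)
qed

lemma locally_conic_cmult:
  assumes "locally_conic f x"
  shows "locally_conic (\<lambda>y. a * f y) x"
  by (rule locally_conic_compose[OF locally_conic_affine assms])
    (unfold affine_fun_def, rule exI[of _ a], rule exI[of _ 0], simp)

lemma locally_conic_diff:
  assumes "locally_conic f x" "locally_conic g x"
  shows "locally_conic (\<lambda>y. f y - g y) x"
  using locally_conic_add[OF assms(1) locally_conic_cmult[OF assms(2), of "-1"]] by simp

lemma locally_conic_abs:
  fixes s :: real
  shows "locally_conic (\<lambda>s. \<bar>s\<bar>) s"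
proof (rule locally_conicI[where q = "\<lambda>v. if s = 0 then \<bar>v\<bar> else sgn s * v"])
  show "\<forall>\<^sub>F y in nhds s. \<bar>y\<bar> = \<bar>s\<bar> + (if s = 0 then \<bar>y - s\<bar> else sgn s * (y - s))"
  proof (cases "s = 0")
    case False
    \<comment> \<open>Within distance \<open>\<bar>s\<bar>\<close> of \<open>s\<close> the sign
      cannot change, so the absolute value is linear there.\<close>
    then have "\<forall>\<^sub>F y in nhds s. dist y s < \<bar>s\<bar>"
      unfolding eventually_nhds_metric by (intro exI[of _ "\<bar>s\<bar>"]) simp
    then show ?thesis
    proof eventually_elim
      case (elim y)
      then show ?case
        using False by (cases "s < 0") (simp_all add: dist_real_def abs_real_def split: if_splits)
    qed
  qed simp
  show "isCont (\<lambda>s. \<bar>s\<bar>) s"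
    by (intro continuous_intros)
qed (simp add: abs_mult)

text \<open>Expressing the maximum through the absolute value leaves the kink to
  \<open>locally_conic_abs\<close> and composition.\<close>

lemma locally_conic_max:
  assumes "locally_conic f x" "locally_conic g x"
  shows "locally_conic (\<lambda>y. max (f y) (g y)) x"
proof -
  have "(\<lambda>y. max (f y) (g y)) = (\<lambda>y. 1 / 2 * (f y + g y + \<bar>f y - g y\<bar>))"
    by (auto simp: max_def)
  moreover have "locally_conic (\<lambda>y. 1 / 2 * (f y + g y + \<bar>f y - g y\<bar>)) x"
    by (intro locally_conic_cmult locally_conic_add assms
        locally_conic_compose[OF locally_conic_abs] locally_conic_diff)
  ultimately show ?thesis by (simp only:)
qed

lemma locally_conic_min:
  assumes "locally_conic f x" "locally_conic g x"
  shows "locally_conic (\<lambda>y. min (f y) (g y)) x"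
proof -
  have "min (f y) (g y) = f y + g y - max (f y) (g y)" for y
    by (simp add: min_def max_def)
  then show ?thesis
    using assms by (simp add: locally_conic_diff locally_conic_add locally_conic_max)
qed

lemma locally_conic_Max:
  assumes "finite A" "A \<noteq> {}" "\<And>i. i \<in> A \<Longrightarrow> locally_conic (f i) x"
  shows "locally_conic (\<lambda>y. Max ((\<lambda>i. f i y) ` A)) x"
  using assms
  by (induction A rule: finite_ne_induct) (simp_all add: locally_conic_max)

text \<open>Close to \<open>x\<close>, only pieces that agree with \<open>f\<close> at
  \<open>x\<close> can be selected. Hence the slopes of secants through \<open>x\<close> take
  finitely many values, and continuity forces a single slope on each side.\<close>

lemma piecewise_affine_imp_locally_conic:
  fixes f :: "real \<Rightarrow> real"
  assumes "piecewise_affine f"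
  shows "locally_conic f x"
proof -
  obtain P where cont: "continuous_on UNIV f" and P: "finite P" "\<And>p. p \<in> P \<Longrightarrow> affine_fun p"
      and sel: "\<And>y. \<exists>p\<in>P. f y = p y"
    using assms unfolding piecewise_affine_def by blast
  have f_cont: "isCont f y" for y
    using cont by (simp add: continuous_on_eq_continuous_at)
  have p_cont: "isCont p y" if "p \<in> P" for p y
    using locally_conic_affine[OF P(2)[OF that]] unfolding locally_conic_def by blast
  \<comment> \<open>By continuity a piece that misses \<open>f\<close> at \<open>x\<close> also
    misses it nearby; since \<open>P\<close> is finite, one radius \<open>r\<close> serves all
    pieces.\<close>
  have "\<forall>\<^sub>F y in nhds x. p x \<noteq> f x \<longrightarrow> p y \<noteq> f y" if "p \<in> P" for p
  proof (cases "p x = f x")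
    case False
    have "isCont (\<lambda>y. p y - f y) x"
      using p_cont[OF that] f_cont by (intro continuous_intros)
    then have "\<forall>\<^sub>F y in nhds x. p y - f y \<noteq> 0"
      by (rule isCont_eventually_compose) (use False in \<open>simp add: t1_space_nhds\<close>)
    then show ?thesis
      by eventually_elim simp
  qed simp
  then have "\<forall>\<^sub>F y in nhds x. \<forall>p\<in>P. p x \<noteq> f x \<longrightarrow> p y \<noteq> f y"
    using P(1) by (simp add: eventually_ball_finite)
  then obtain r where "r > 0" and r: "\<And>y p. dist y x < r \<Longrightarrow> p \<in> P \<Longrightarrow> p y = f y \<Longrightarrow> p x = f x"
    unfolding eventually_nhds_metric by blast
  define slope where "slope y = (f y - f x) / (y - x)" for y
  have finite_slopes: "finite (slope ` S)" if "S \<subseteq> ball x r - {x}" for S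
  proof (rule finite_subset)
    \<comment> \<open>For an affine \<open>p\<close> on the reals, \<open>p 1 - p 0\<close> is its
      slope.\<close>
    show "finite ((\<lambda>p. p 1 - p 0) ` P)"
      using P(1) by simp
    show "slope ` S \<subseteq> (\<lambda>p. p 1 - p 0) ` P"
    proof
      fix m assume "m \<in> slope ` S"
      then obtain y where y: "m = slope y" "dist y x < r" "y \<noteq> x"
        using \<open>S \<subseteq> ball x r - {x}\<close> by (fastforce simp: dist_commute)
      obtain p where p: "p \<in> P" "f y = p y"
        using sel by blast
      then have "p x = f x"
        using r y by metis
      obtain a b where ab: "\<And>z. p z = a * z + b"
        using P(2)[OF p(1)] unfolding affine_fun_def by auto
      have "f y - f x = p y - p x"
        using p(2) \<open>p x = f x\<close> by simp
      also have "\<dots> = a * (y - x)"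
        by (simp add: ab right_diff_distrib)
      finally have "slope y = p 1 - p 0"
        using y(3) by (simp add: slope_def ab)
      then show "m \<in> (\<lambda>p. p 1 - p 0) ` P"
        using y(1) p(1) by blast
    qed
  qed
  \<comment> \<open>A continuous function with finite range is constant on a connected set; this is
    applied to the open intervals on either side of \<open>x\<close>.\<close>
  have const: "\<exists>m. \<forall>y\<in>S. slope y = m" if "connected S" "S \<subseteq> ball x r - {x}" for S
  proof -
    have "continuous_on S slope"
      unfolding slope_def using that(2)
      by (intro continuous_intros continuous_on_subset[OF cont]) auto
    then have "slope constant_on S"
      using continuous_finite_range_constant[OF that(1)] finite_slopes[OF that(2)] by blast
    then show ?thesis
      unfolding constant_on_def .
  qed
  have "{x<..<x + r} \<subseteq> ball x r - {x}" "{x - r<..<x} \<subseteq> ball x r - {x}"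
    by (auto simp: dist_real_def)
  then obtain m n where m: "\<And>y. y \<in> {x<..<x + r} \<Longrightarrow> slope y = m"
      and n: "\<And>y. y \<in> {x - r<..<x} \<Longrightarrow> slope y = n"
    using const connected_Ioo by metis
  show ?thesis
  proof (rule locally_conicI[where q = "\<lambda>v. if v \<ge> 0 then m * v else n * v"])
    have "\<forall>\<^sub>F y in nhds x. dist y x < r"
      unfolding eventually_nhds_metric using \<open>r > 0\<close> by blast
    then show "\<forall>\<^sub>F y in nhds x. f y = f x + (if y - x \<ge> 0 then m * (y - x) else n * (y - x))"
    proof eventually_elim
      case (elim y)
      consider "y = x" | "y \<in> {x<..<x + r}" | "y \<in> {x - r<..<x}"
        using elim by (auto simp: dist_real_def abs_less_iff not_less) linarith+
      then show ?case
      proof cases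
        case 2
        then show ?thesis
          using m[OF 2] by (simp add: slope_def field_simps)
      next
        case 3
        then show ?thesis
          using n[OF 3] by (simp add: slope_def field_simps)
      qed simp
    qed
  qed (auto simp: f_cont zero_le_mult_iff)
qed

text \<open>For small \<open>t > 0\<close> the inner value is exactly \<open>f x + t * q v\<close>,
  so the quotient in direction \<open>v\<close> is that of \<open>\<phi>\<close> in direction
  \<open>q v\<close>. The lower bound for \<open>\<phi>\<close> is likewise evaluated at the
  increment \<open>q (y - x)\<close>.\<close>

lemma convex_like_near_compose:
  assumes "convex_like_near \<phi> (f x)" "locally_conic f x"
  shows "convex_like_near (\<lambda>y. \<phi> (f y)) x"
proof -
  obtain D where D: "\<And>v. has_dir_deriv \<phi> (f x) v (D v)"
      and le: "\<forall>\<^sub>F s in nhds (f x). \<phi> (f x) + D (s - f x) \<le> \<phi> s"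
    using assms(1) unfolding convex_like_near_iff by blast
  obtain q where q: "isCont f x" "\<And>t v. t > 0 \<Longrightarrow> q (t *\<^sub>R v) = t * q v"
      "\<forall>\<^sub>F y in nhds x. f y = f x + q (y - x)"
    using assms(2) unfolding locally_conic_def by blast
  have "has_dir_deriv (\<lambda>y. \<phi> (f y)) x v (D (q v))" for v
    using D[of "q v"] unfolding has_dir_deriv_def
    by (rule Lim_transform_eventually)
      (use eventually_ray[OF q(3), of v] eventually_at_right_less[of 0] in eventually_elim,
        simp add: q(2))
  moreover have "\<forall>\<^sub>F y in nhds x. \<phi> (f x) + D (q (y - x)) \<le> \<phi> (f y)"
    using isCont_eventually_compose[OF q(1) le] q(3) by eventually_elim simp
  ultimately show ?thesis
    unfolding convex_like_near_iff by (intro exI[of _ "\<lambda>v. D (q v)"]) simp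
qed

text \<open>The identity on the reals is convex, hence an admissible outer function for the
  composition rule.\<close>

lemma locally_conic_imp_convex_like_near:
  assumes "locally_conic f x"
  shows "convex_like_near f x"
  using convex_like_near_compose[of "\<lambda>s. s", OF convex_on_imp_convex_like_near assms]
  by (simp add: convex_on_ident)

section \<open>Truncations of convex, concave and piecewise affine functions\<close>

lemma convex_on_max_const:
  assumes "convex_on S f"
  shows "convex_on S (\<lambda>y. max (f y) c)"
  unfolding convex_on_def
proof (intro conjI ballI allI impI)
  show "convex S"
    using assms by (rule convex_on_imp_convex)
next
  fix x y u v assume A: "x \<in> S" "y \<in> S" "0 \<le> u" "0 \<le> v" "u + v = (1::real)"
  then have "f (u *\<^sub>R x + v *\<^sub>R y) \<le> u * f x + v * f y"
    using assms unfolding convex_on_def by blast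
  also have "\<dots> \<le> u * max (f x) c + v * max (f y) c"
    using A by (intro add_mono mult_left_mono) auto
  finally have "f (u *\<^sub>R x + v *\<^sub>R y) \<le> u * max (f x) c + v * max (f y) c" .
  moreover have "u * c + v * c \<le> u * max (f x) c + v * max (f y) c"
    using A by (intro add_mono mult_left_mono) auto
  ultimately show "max (f (u *\<^sub>R x + v *\<^sub>R y)) c \<le> u * max (f x) c + v * max (f y) c"
    using A by (simp add: distrib_right[symmetric])
qed

text \<open>The inner maximum is still convex, hence continuous on the whole line, so the outer
  minimum falls under \<open>convex_like_near_min\<close>.\<close>

lemma convex_like_near_truncation:
  fixes \<theta> :: "real \<Rightarrow> real"
  assumes "convex_on UNIV \<theta>"
  shows "convex_like_near (\<lambda>s. min (max (\<theta> s) a) b) s"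
proof -
  have "convex_on UNIV (\<lambda>s. max (\<theta> s) a)"
    using assms by (rule convex_on_max_const)
  moreover from this have "isCont (\<lambda>s. max (\<theta> s) a) s"
    using convex_on_continuous[of UNIV "\<lambda>s. max (\<theta> s) a"]
    by (simp add: continuous_on_eq_continuous_at)
  ultimately show ?thesis
    by (intro convex_like_near_min convex_on_imp_convex_like_near convex_like_near_const
        continuous_const)
qed

lemma convex_like_near_phi_ub:
  assumes "convex_on UNIV \<theta>" "locally_conic f x"
  shows "convex_like_near (\<lambda>y. phi_ub \<theta> (f y) \<gamma>) x"
proof -
  have "locally_conic (\<lambda>y. 1 + 1 / \<gamma> * f y) x"
    using assms(2) by (intro locally_conic_add locally_conic_const locally_conic_cmult)
  from convex_like_near_compose[of _ "\<lambda>y. 1 + 1 / \<gamma> * f y", OF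
      convex_like_near_truncation[OF assms(1), of 0 1] this]
  show ?thesis
    by (simp add: phi_ub_def)
qed

text \<open>Negation swaps \<open>min\<close> and \<open>max\<close>: the negative of the truncated
  concave function is the convex \<open>-\<theta>\<close> truncated to the interval from -1 to
  0.\<close>

lemma convex_like_near_uminus_phi_lb:
  assumes "concave_on UNIV \<theta>" "locally_conic f x"
  shows "convex_like_near (\<lambda>y. - phi_lb \<theta> (f y) \<gamma>) x"
proof -
  have "convex_on UNIV (\<lambda>s. - \<theta> s)"
    using assms(1) by (simp add: concave_on_def)
  from convex_like_near_compose[of _ "\<lambda>y. 1 / \<gamma> * f y", OF
      convex_like_near_truncation[OF this, of "-1" 0] locally_conic_cmult[OF assms(2)]]
  have "convex_like_near (\<lambda>y. min (max (- \<theta> (f y / \<gamma>)) (-1)) 0) x"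
    by simp
  moreover have "min (max (- a) (-1)) 0 = - max (min a 1) 0" for a :: real
    by (simp add: min_def max_def)
  ultimately show ?thesis
    by (simp add: phi_lb_def)
qed

lemma locally_conic_phi_ub:
  assumes "piecewise_affine \<theta>" "locally_conic f x"
  shows "locally_conic (\<lambda>y. phi_ub \<theta> (f y) \<gamma>) x"
proof -
  have "locally_conic (\<lambda>y. \<theta> (1 + 1 / \<gamma> * f y)) x"
    by (intro locally_conic_compose[OF piecewise_affine_imp_locally_conic[OF assms(1)]]
        locally_conic_add locally_conic_const locally_conic_cmult assms(2))
  then show ?thesis
    unfolding phi_ub_def by (intro locally_conic_min locally_conic_max locally_conic_const) simp
qed

lemma locally_conic_phi_lb:
  assumes "piecewise_affine \<theta>" "locally_conic f x"
  shows "locally_conic (\<lambda>y. phi_lb \<theta> (f y) \<gamma>) x"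
proof -
  have "locally_conic (\<lambda>y. \<theta> (1 / \<gamma> * f y)) x"
    by (intro locally_conic_compose[OF piecewise_affine_imp_locally_conic[OF assms(1)]]
        locally_conic_cmult assms(2))
  then show ?thesis
    unfolding phi_lb_def by (intro locally_conic_min locally_conic_max locally_conic_const) simp
qed

section \<open>Tangent directions and local minimality\<close>

lemma diff_mem_tangent_cone:
  assumes "convex X" "xb \<in> X" "x \<in> X"
  shows "x - xb \<in> tangent_cone xb X"
proof -
  \<comment> \<open>The shift by \<open>Suc\<close> keeps the step positive and at most 1, so that
    \<open>\<xi> n\<close> stays on the segment from \<open>xb\<close> to \<open>x\<close>, where
    the scaled increment is constantly \<open>x - xb\<close>.\<close>
  define \<tau> where "\<tau> n = inverse (real (Suc n))" for n
  define \<xi> where "\<xi> n = xb + \<tau> n *\<^sub>R (x - xb)" for n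
  have \<tau>: "0 < \<tau> n" "\<tau> n \<le> 1" for n
    by (auto simp: \<tau>_def field_simps)
  have lim: "\<tau> \<longlonglongrightarrow> 0"
    unfolding \<tau>_def by (rule LIMSEQ_inverse_real_of_nat)
  have "\<xi> n \<in> X" for n
    using convexD_alt[OF assms, of "\<tau> n"] \<tau>[of n] by (simp add: \<xi>_def algebra_simps)
  moreover have "\<xi> \<longlonglongrightarrow> xb"
    unfolding \<xi>_def using tendsto_add[OF tendsto_const tendsto_scaleR[OF lim tendsto_const]]
    by (metis add_0_right scaleR_zero_left)
  moreover have "(\<xi> n - xb) /\<^sub>R \<tau> n = x - xb" for n
    using \<tau>(1)[of n] by (simp add: \<xi>_def)
  ultimately show ?thesis
    unfolding tangent_cone_def using \<tau>(1) lim by (auto intro!: exI[of _ \<xi>] exI[of _ \<tau>])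
qed

lemma B_stationary_imp_local_minimizer:
  assumes X: "convex X"
    and stat: "B_stationary F (constraint_set X K f) xb"
    and F: "convex_like_near F xb"
    and f: "\<And>k. k \<in> {1..K} \<Longrightarrow> convex_like_near (f k) xb"
    and acq: "ACQ X K f xb"
  shows "local_minimizer F (constraint_set X K f) xb"
proof -
  let ?C = "constraint_set X K f"
  have xb: "xb \<in> ?C"
    using acq by (simp add: ACQ_def)
  \<comment> \<open>There are finitely many constraints, so a common neighborhood exists.\<close>
  have "\<forall>\<^sub>F x in nhds xb. \<forall>k\<in>{1..K}. f k xb + dir_deriv (f k) xb (x - xb) \<le> f k x"
    using f by (intro eventually_ball_finite) (auto intro: convex_like_near_dir_deriv)
  then have "\<forall>\<^sub>F x in nhds xb. x \<in> ?C \<longrightarrow> F xb \<le> F x"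
    using convex_like_near_dir_deriv[OF F]
  proof eventually_elim
    case (elim x)
    show ?case
    proof
      assume x: "x \<in> ?C"
      have "x - xb \<in> tangent_cone xb X"
        using X xb x by (intro diff_mem_tangent_cone) (auto simp: constraint_set_def)
      moreover have "dir_deriv (f k) xb (x - xb) \<le> 0" if "k \<in> {1..K}" "f k xb = 0" for k
      proof -
        have "f k x \<le> 0"
          using x that(1) by (simp add: constraint_set_def)
        then show ?thesis
          using elim(1) that by fastforce
      qed
      ultimately have "x - xb \<in> tangent_cone xb ?C"
        using acq by (auto simp: ACQ_def linearization_cone_def)
      then show "F xb \<le> F x"
        using stat elim(2) by (fastforce simp: B_stationary_def)
    qed
  qed
  then show ?thesis
    using xb unfolding local_minimizer_def eventually_nhds by blast
qed

theorem corollary11: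
  fixes X :: "(real ^ 'n) set"
    and \<Xi> :: "(real ^ 'd) set"
    and K L N :: nat
    and I J :: "nat \<Rightarrow> nat"
    and g h :: "nat \<Rightarrow> nat \<Rightarrow> real ^ 'n \<Rightarrow> real ^ 'd \<Rightarrow> real"
    and \<theta>cvx \<theta>cve :: "real \<Rightarrow> real"
    and e :: "nat \<Rightarrow> nat \<Rightarrow> real"
    and c :: "nat \<Rightarrow> nat \<Rightarrow> real ^ 'n \<Rightarrow> real ^ 'd \<Rightarrow> real \<Rightarrow> real"
    and c0 :: "real ^ 'n \<Rightarrow> real ^ 'd \<Rightarrow> real"
    and zs :: "nat \<Rightarrow> real ^ 'd"
    and \<zeta> :: "nat \<Rightarrow> real"
    and \<gamma> :: real
  assumes X: "polyhedron X"
    and \<gamma>: "\<gamma> > 0"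
    and N: "N \<ge> 1"
    and samples: "\<forall>s\<in>{1..N}. zs s \<in> \<Xi>"
    and IJ: "\<forall>l\<in>{1..L}. I l \<ge> 1 \<and> J l \<ge> 1"
    and theta: "theta_admissible \<theta>cvx" "theta_admissible \<theta>cve"
    and c0_dd: "\<forall>z\<in>\<Xi>. \<forall>x. dir_differentiable (\<lambda>x. c0 x z) x"
    and c0_lip: "\<forall>z\<in>\<Xi>. \<exists>B. B-lipschitz_on UNIV (\<lambda>x. c0 x z)"
    and g_affine: "\<forall>z\<in>\<Xi>. \<forall>l\<in>{1..L}. \<forall>i\<in>{1..I l}. affine_fun (\<lambda>x. g i l x z)"
    and h_affine: "\<forall>z\<in>\<Xi>. \<forall>l\<in>{1..L}. \<forall>j\<in>{1..J l}. affine_fun (\<lambda>x. h j l x z)"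
    and cases:
      "(\<forall>k\<in>{1..K}. \<forall>l\<in>{1..L}. \<forall>z\<in>\<Xi>. \<forall>x.
          c k l x z \<gamma> = c_rst e \<theta>cvx \<theta>cve (Z_fun g h I J) k l x z \<gamma>) \<and>
        convex_on UNIV \<theta>cvx \<and> concave_on UNIV \<theta>cve \<or>
       (\<forall>k\<in>{1..K}. \<forall>l\<in>{1..L}. \<forall>z\<in>\<Xi>. \<forall>x.
          c k l x z \<gamma> = c_rlx e \<theta>cvx \<theta>cve (Z_fun g h I J) k l x z \<gamma>) \<and>
        piecewise_affine \<theta>cvx \<and> piecewise_affine \<theta>cve"
  shows
    "(\<forall>xb\<in>X. \<forall>k\<in>{1..K}. \<forall>l\<in>{1..L}. \<forall>z\<in>\<Xi>. convex_like_near (\<lambda>x. c k l x z \<gamma>) xb) \<and>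
     (\<forall>xb. B_stationary (emp_objective c0 N zs)
              (constraint_set X K (emp_constraint c L N zs \<zeta> \<gamma>)) xb \<and>
            (\<forall>z\<in>\<Xi>. convex_like_near (\<lambda>x. c0 x z) xb) \<and>
            ACQ X K (emp_constraint c L N zs \<zeta> \<gamma>) xb \<longrightarrow>
        local_minimizer (emp_objective c0 N zs)
          (constraint_set X K (emp_constraint c L N zs \<zeta> \<gamma>)) xb)"
proof -
  \<comment> \<open>\<open>IJ\<close> makes both index ranges nonempty, as
    \<open>locally_conic_Max\<close> requires.\<close>
  have Z: "locally_conic (\<lambda>x. Z_fun g h I J l x z) x" if "l \<in> {1..L}" "z \<in> \<Xi>" for l z x
    unfolding Z_fun_def using IJ g_affine h_affine that
    by (intro locally_conic_diff locally_conic_Max locally_conic_affine) auto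
  have c: "convex_like_near (\<lambda>x. c k l x z \<gamma>) x"
    if k: "k \<in> {1..K}" and l: "l \<in> {1..L}" and z: "z \<in> \<Xi>" for k l z x
    using cases
  proof (elim disjE conjE)
    assume eq: "\<forall>k\<in>{1..K}. \<forall>l\<in>{1..L}. \<forall>z\<in>\<Xi>. \<forall>x.
        c k l x z \<gamma> = c_rst e \<theta>cvx \<theta>cve (Z_fun g h I J) k l x z \<gamma>"
      and \<theta>: "convex_on UNIV \<theta>cvx" "concave_on UNIV \<theta>cve"
    \<comment> \<open>The minus sign is moved onto \<open>phi_lb\<close>, leaving a combination of
      convex-like functions with nonnegative coefficients.\<close>
    have "convex_like_near (\<lambda>x. max (e k l) 0 * phi_ub \<theta>cvx (Z_fun g h I J l x z) \<gamma> +
        max (- e k l) 0 * - phi_lb \<theta>cve (Z_fun g h I J l x z) \<gamma>) x"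
      by (intro convex_like_near_add convex_like_near_cmult convex_like_near_phi_ub
          convex_like_near_uminus_phi_lb \<theta> Z l z) simp_all
    then show ?thesis
      using eq k l z by (simp add: c_rst_def)
  next
    assume eq: "\<forall>k\<in>{1..K}. \<forall>l\<in>{1..L}. \<forall>z\<in>\<Xi>. \<forall>x.
        c k l x z \<gamma> = c_rlx e \<theta>cvx \<theta>cve (Z_fun g h I J) k l x z \<gamma>"
      and \<theta>: "piecewise_affine \<theta>cvx" "piecewise_affine \<theta>cve"
    \<comment> \<open>Here \<open>phi_ub\<close> enters with a nonpositive coefficient, so the
      argument runs through conic functions, which may be subtracted.\<close>
    have "locally_conic (\<lambda>x. max (e k l) 0 * phi_lb \<theta>cve (Z_fun g h I J l x z) \<gamma> -
        max (- e k l) 0 * phi_ub \<theta>cvx (Z_fun g h I J l x z) \<gamma>) x"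
      by (intro locally_conic_diff locally_conic_cmult locally_conic_phi_ub
          locally_conic_phi_lb \<theta> Z l z)
    then show ?thesis
      using eq k l z by (simp add: c_rlx_def locally_conic_imp_convex_like_near)
  qed
  have "convex_like_near (emp_objective c0 N zs) x"
    if "\<forall>z\<in>\<Xi>. convex_like_near (\<lambda>x. c0 x z) x" for x
    unfolding emp_objective_def using that samples
    by (intro convex_like_near_cmult convex_like_near_sum) auto
  moreover have "convex_like_near (emp_constraint c L N zs \<zeta> \<gamma> k) x" if "k \<in> {1..K}" for k x
    unfolding emp_constraint_def diff_conv_add_uminus using that samples
    by (intro convex_like_near_add convex_like_near_const convex_like_near_cmult
        convex_like_near_sum c) auto
  ultimately show ?thesis
    using c polyhedron_imp_convex[OF X] by (blast intro: B_stationary_imp_local_minimizer)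
qed

end
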